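(* For a random real matrix $\mathbf{X}=[X_{jk}]$ write \[ T_1(\mathbf{X})=\sum_{k}\Big(\sum_{j}\mathrm{Var}(X_{jk})\Big)^{1/2},\qquad T_2(\mathbf{X})=\sum_{j}\Big(\sum_{k}\mathrm{Var}(X_{jk})\Big)^{1/2}. \] Each of the two terms in the bound $\mathbb{E}\|\mathbf{A}-\mathbf{X}\|_{\infty\to1}\le 2[T_1(\mathbf{X})+T_2(\mathbf{X})]$ (for random $\mathbf{X}$ with independent entries and $\mathbb{E}\mathbf{X}=\mathbf{A}$) is necessary, in the following sense. There exist a sequence of fixed real matrices $\mathbf{A}_N$ and random matrices $\mathbf{X}_N$ of the same sizes with independent entries and $\mathbb{E}\mathbf{X}_N=\mathbf{A}_N$, and absolute constants $0<c\le C$, such that for all $N\geq 1$ \[ c\,T_2(\mathbf{X}_N)\le \mathbb{E}\|\mathbf{A}_N-\mathbf{X}_N\|_{\infty\to1}\le C\,T_2(\mathbf{X}_N)\quad\text{and}\quad \frac{\mathbb{E}\|\mathbf{A}_N-\mathbf{X}_N\|_{\infty\to1}}{T_1(\mathbf{X}_N)}\to\infty \text{ as } N\to\infty; \] and there likewise exists such a sequence for which the same holds with the roles of $T_1$ and $T_2$ exchanged.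
   Context: For a real matrix $\mathbf{B}$, $\|\mathbf{B}\|_{\infty\to1}=\max_{\mathbf{u}\ne\mathbf{0}}\|\mathbf{B}\mathbf{u}\|_1/\|\mathbf{u}\|_\infty$. $\mathrm{Var}(X)=\mathbb{E}(X-\mathbb{E}X)^2$. The index $j$ runs over rows and $k$ over columns. The expectation of a random matrix is taken entrywise. *)

theory Defs
  imports "HOL-Probability.Probability" "Jordan_Normal_Form.Matrix"
begin

definition l1_norm :: "real vec \<Rightarrow> real" where
  "l1_norm v = (\<Sum>i<dim_vec v. \<bar>vec_index v i\<bar>)"

(* Only meaningful for dim_vec v > 0. *)
definition linf_norm :: "real vec \<Rightarrow> real" where
  "linf_norm v = Max ((\<lambda>i. \<bar>vec_index v i\<bar>) ` {..<dim_vec v})"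

(* For a matrix with at least one column the supremum is over a nonempty set of reals that is
   bounded above, and it is attained, so it is the maximum. *)
definition inf_to_one_norm :: "real mat \<Rightarrow> real" where
  "inf_to_one_norm B =
     (SUP u \<in> {u \<in> carrier_vec (dim_col B). u \<noteq> 0\<^sub>v (dim_col B)}.
        l1_norm (B *\<^sub>v u) / linf_norm u)"

(* Square-integrability of the entries makes all means and variances below genuine finite
   quantities; the Bochner integral of a non-integrable function is 0 by convention.
   Measurability of the entries is part of indep_vars. *)
definition indep_random_matrix ::
    "'w measure \<Rightarrow> nat \<Rightarrow> nat \<Rightarrow> ('w \<Rightarrow> real mat) \<Rightarrow> bool" where
  "indep_random_matrix M m n X \<longleftrightarrow>
     prob_space M \<and> 0 < m \<and> 0 < n \<and>
     (\<forall>\<omega>\<in>space M. X \<omega> \<in> carrier_mat m n) \<and>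
     prob_space.indep_vars M (\<lambda>_. borel) (\<lambda>jk \<omega>. X \<omega> $$ jk) ({..<m} \<times> {..<n}) \<and>
     (\<forall>j<m. \<forall>k<n. integrable M (\<lambda>\<omega>. (X \<omega> $$ (j, k))\<^sup>2))"

definition expectation_mat :: "'w measure \<Rightarrow> nat \<Rightarrow> nat \<Rightarrow> ('w \<Rightarrow> real mat) \<Rightarrow> real mat" where
  "expectation_mat M m n X = mat m n (\<lambda>(j, k). prob_space.expectation M (\<lambda>\<omega>. X \<omega> $$ (j, k)))"

definition T1 :: "'w measure \<Rightarrow> nat \<Rightarrow> nat \<Rightarrow> ('w \<Rightarrow> real mat) \<Rightarrow> real" where
  "T1 M m n X = (\<Sum>k<n. sqrt (\<Sum>j<m. prob_space.variance M (\<lambda>\<omega>. X \<omega> $$ (j, k))))"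

definition T2 :: "'w measure \<Rightarrow> nat \<Rightarrow> nat \<Rightarrow> ('w \<Rightarrow> real mat) \<Rightarrow> real" where
  "T2 M m n X = (\<Sum>j<m. sqrt (\<Sum>k<n. prob_space.variance M (\<lambda>\<omega>. X \<omega> $$ (j, k))))"

end

theory Submission
  imports Defs
begin

text \<open>Random signs: a matrix with entries \<open>\<plusminus>1\<close> that has only one column or only one row has rank one,
  so its norm equals the number of its entries, whatever the signs are. Thus for a column of \<open>N\<close>
  independent signs with mean zero, the expected norm and \<open>T2\<close> are both \<open>N\<close> while
  \<open>T1\<close> is \<open>sqrt N\<close>; a row exchanges the two.\<close>

lemma abs_le_linf_norm:
  assumes "i < dim_vec v"
  shows "\<bar>v $ i\<bar> \<le> linf_norm v"
  unfolding linf_norm_def using assms by (intro Max_ge) auto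

lemma linf_norm_pos:
  assumes "v \<in> carrier_vec n" "v \<noteq> 0\<^sub>v n"
  shows "linf_norm v > 0"
proof -
  obtain i where "i < n" "v $ i \<noteq> 0"
    using assms by (metis carrier_vecD eq_vecI index_zero_vec)
  then show ?thesis
    using abs_le_linf_norm[of i v] assms(1) by auto
qed

text \<open>Entry j of B u is a j times the pairing of b with u, so the l1 norm of B u is m times
  the absolute value of that single pairing. The triangle inequality bounds the pairing by n times
  \<open>linf_norm u\<close>, and u = b attains this bound.\<close>

lemma inf_to_one_norm_rank_one_signs:
  assumes B: "B \<in> carrier_mat m n" and n: "0 < n"
    and entry: "\<And>j k. j < m \<Longrightarrow> k < n \<Longrightarrow> B $$ (j, k) = a j * b k"
    and a: "\<And>j. j < m \<Longrightarrow> \<bar>a j\<bar> = 1" and b: "\<And>k. k < n \<Longrightarrow> \<bar>b k\<bar> = 1"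
  shows "inf_to_one_norm B = real m * real n"
  unfolding inf_to_one_norm_def
proof (rule cSup_eq_maximum)
  have prod_entry: "(B *\<^sub>v u) $ j = a j * (\<Sum>k<n. b k * u $ k)"
    if "j < m" "u \<in> carrier_vec n" for j u
    using that B entry
    by (auto simp: scalar_prod_def sum_distrib_left lessThan_atLeast0 mult.assoc intro!: sum.cong)
  have l1: "l1_norm (B *\<^sub>v u) = real m * \<bar>\<Sum>k<n. b k * u $ k\<bar>"
    if "u \<in> carrier_vec n" for u
  proof -
    have "l1_norm (B *\<^sub>v u) = (\<Sum>j<m. \<bar>\<Sum>k<n. b k * u $ k\<bar>)"
      unfolding l1_norm_def
    proof (rule sum.cong)
      show "{..<dim_vec (B *\<^sub>v u)} = {..<m}" using B by simp
    qed (use prod_entry that a in \<open>auto simp: abs_mult\<close>)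
    then show ?thesis by simp
  qed
  \<comment> \<open>The maximiser: pairing b with itself makes every summand equal to 1, so no
    cancellation occurs and the sum is n.\<close>
  define w where "w = vec n b"
  have w: "w \<in> carrier_vec n" "w \<noteq> 0\<^sub>v n"
    using b[OF n] n by (auto simp: w_def dest!: arg_cong[where f = "\<lambda>v. vec_index v 0"])
  have "(\<lambda>i. \<bar>w $ i\<bar>) ` {..<n} = {1}"
    using b n by (force simp: w_def)
  then have "linf_norm w = 1"
    by (simp add: linf_norm_def w_def)
  moreover have "b k * b k = 1" if "k < n" for k
    using b[OF that] by (metis abs_mult_self_eq mult_1)
  then have "(\<Sum>k<n. b k * w $ k) = real n"
    by (simp add: w_def)
  ultimately have "real m * real n = l1_norm (B *\<^sub>v w) / linf_norm w"
    using l1[OF w(1)] by simp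
  then show "real m * real n \<in> (\<lambda>u. l1_norm (B *\<^sub>v u) / linf_norm u) `
      {u \<in> carrier_vec (dim_col B). u \<noteq> 0\<^sub>v (dim_col B)}"
    using w B by auto
  fix x assume "x \<in> (\<lambda>u. l1_norm (B *\<^sub>v u) / linf_norm u) `
      {u \<in> carrier_vec (dim_col B). u \<noteq> 0\<^sub>v (dim_col B)}"
  then obtain u where u: "u \<in> carrier_vec n" "u \<noteq> 0\<^sub>v n"
    and x: "x = l1_norm (B *\<^sub>v u) / linf_norm u"
    using B by auto
  have "\<bar>\<Sum>k<n. b k * u $ k\<bar> \<le> (\<Sum>k<n. \<bar>b k * u $ k\<bar>)"
    by (rule sum_abs)
  also have "\<dots> \<le> (\<Sum>k<n. linf_norm u)"
    using u b abs_le_linf_norm[of _ u] by (intro sum_mono) (auto simp: abs_mult)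
  finally have "\<bar>\<Sum>k<n. b k * u $ k\<bar> \<le> real n * linf_norm u"
    by simp
  then have "l1_norm (B *\<^sub>v u) \<le> real m * (real n * linf_norm u)"
    unfolding l1[OF u(1)] by (intro mult_left_mono) auto
  then show "x \<le> real m * real n"
    using linf_norm_pos[OF u] by (simp add: x divide_le_eq mult.assoc)
qed

text \<open>A discrete law on the reals in which every set is measurable, so that measurability of
  any function of a single sign is automatic.\<close>

definition fair_sign :: "real measure" where
  "fair_sign = measure_pmf (pmf_of_set {-1, 1})"

definition sign_space :: "nat \<Rightarrow> nat \<Rightarrow> (nat \<times> nat \<Rightarrow> real) measure" where
  "sign_space m n = PiM ({..<m} \<times> {..<n}) (\<lambda>_. fair_sign)"

text \<open>Coordinates take the values \<open>\<plusminus>1\<close> only almost surely; \<open>to_sign\<close> makes this hold everywhere.\<close>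

definition to_sign :: "real \<Rightarrow> real" where
  "to_sign x = (if x > 0 then 1 else -1)"

definition sign_matrix :: "nat \<Rightarrow> nat \<Rightarrow> (nat \<times> nat \<Rightarrow> real) \<Rightarrow> real mat" where
  "sign_matrix m n \<omega> = mat m n (\<lambda>jk. to_sign (\<omega> jk))"

lemma abs_to_sign [simp]: "\<bar>to_sign x\<bar> = 1"
  by (simp add: to_sign_def)

lemma to_sign_squared [simp]: "(to_sign x)\<^sup>2 = 1"
  by (simp add: to_sign_def)

lemma sign_matrix_carrier [simp]: "sign_matrix m n \<omega> \<in> carrier_mat m n"
  by (simp add: sign_matrix_def)

lemma dim_sign_matrix [simp]:
  "dim_row (sign_matrix m n \<omega>) = m" "dim_col (sign_matrix m n \<omega>) = n"
  by (simp_all add: sign_matrix_def)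

lemma index_sign_matrix [simp]:
  "j < m \<Longrightarrow> k < n \<Longrightarrow> sign_matrix m n \<omega> $$ (j, k) = to_sign (\<omega> (j, k))"
  by (simp add: sign_matrix_def)

lemma prob_space_fair_sign: "prob_space fair_sign"
  unfolding fair_sign_def by (rule prob_space_measure_pmf)

lemma prob_space_sign_space: "prob_space (sign_space m n)"
  unfolding sign_space_def by (intro prob_space_PiM prob_space_fair_sign)

lemma measurable_fair_sign [simp]: "f \<in> measurable fair_sign borel"
  unfolding fair_sign_def by simp

text \<open>A single coordinate of the product measure has law \<open>fair_sign\<close>, which
  reduces the integral to the average of 1 and -1.\<close>

lemma expectation_to_sign:
  assumes "i \<in> {..<m} \<times> {..<n}"
  shows "(\<integral>\<omega>. to_sign (\<omega> i) \<partial>sign_space m n) = 0"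
proof -
  have "(\<integral>\<omega>. to_sign (\<omega> i) \<partial>sign_space m n)
      = (\<integral>x. to_sign x \<partial>distr (sign_space m n) fair_sign (\<lambda>\<omega>. \<omega> i))"
    unfolding sign_space_def using assms
    by (intro integral_distr[symmetric] measurable_component_singleton) auto
  also have "distr (sign_space m n) fair_sign (\<lambda>\<omega>. \<omega> i) = fair_sign"
    unfolding sign_space_def using assms
    by (intro distr_PiM_component prob_space_fair_sign) auto
  also have "(\<integral>x. to_sign x \<partial>fair_sign) = 0"
    by (simp add: fair_sign_def integral_pmf_of_set to_sign_def)
  finally show ?thesis .
qed

text \<open>The coordinates are independent because their joint law is the product of their
  marginals; applying \<open>to_sign\<close> to each one preserves independence.\<close>

lemma indep_vars_to_sign:
  assumes "0 < m" "0 < n"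
  shows "prob_space.indep_vars (sign_space m n) (\<lambda>_. borel) (\<lambda>i \<omega>. to_sign (\<omega> i)) ({..<m} \<times> {..<n})"
proof -
  interpret prob_space "sign_space m n" by (rule prob_space_sign_space)
  let ?I = "{..<m} \<times> {..<n}"
  let ?P = "PiM ?I (\<lambda>_. fair_sign)"
  \<comment> \<open>Points of the product space are extensional, so restricting them to the index
    set changes nothing.\<close>
  have "distr ?P ?P (\<lambda>\<omega>. \<lambda>i\<in>?I. \<omega> i) = distr ?P ?P (\<lambda>\<omega>. \<omega>)"
    by (intro distr_cong) (auto simp: space_PiM PiE_def extensional_restrict)
  also have "\<dots> = ?P"
    by simp
  also have "\<dots> = PiM ?I (\<lambda>i. distr ?P fair_sign (\<lambda>\<omega>. \<omega> i))"
    by (intro PiM_cong distr_PiM_component[symmetric] prob_space_fair_sign) auto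
  finally have "indep_vars (\<lambda>_. fair_sign) (\<lambda>i \<omega>. \<omega> i) ?I"
    using assms unfolding sign_space_def
    \<comment> \<open>This criterion asks for a nonempty index set, which is where positivity of m
      and n enters.\<close>
    by (subst prob_space.indep_vars_iff_distr_eq_PiM')
      (auto simp: lessThan_empty_iff intro!: prob_space_PiM prob_space_fair_sign)
  then show ?thesis
    by (rule indep_vars_compose2) simp
qed

lemma indep_random_matrix_sign_matrix:
  assumes "0 < m" "0 < n"
  shows "indep_random_matrix (sign_space m n) m n (sign_matrix m n)"
proof -
  interpret prob_space "sign_space m n" by (rule prob_space_sign_space)
  have "indep_vars (\<lambda>_. borel) (\<lambda>jk \<omega>. sign_matrix m n \<omega> $$ jk) ({..<m} \<times> {..<n})"
    using indep_vars_to_sign[OF assms] by (rule back_subst) (intro indep_vars_cong, auto)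
  \<comment> \<open>Squared entries are identically 1, so square-integrability is that of a constant
    on a probability space.\<close>
  then show ?thesis
    using assms by (simp add: indep_random_matrix_def prob_space_axioms)
qed

lemma expectation_sign_matrix:
  "expectation_mat (sign_space m n) m n (sign_matrix m n) = 0\<^sub>m m n"
  unfolding expectation_mat_def by (rule eq_matI) (simp_all add: expectation_to_sign)

lemma variance_sign_matrix:
  assumes "j < m" "k < n"
  shows "prob_space.variance (sign_space m n) (\<lambda>\<omega>. sign_matrix m n \<omega> $$ (j, k)) = 1"
proof -
  interpret prob_space "sign_space m n" by (rule prob_space_sign_space)
  show ?thesis
    using assms by (simp add: expectation_to_sign prob_space)
qed

lemma T1_sign_matrix: "T1 (sign_space m n) m n (sign_matrix m n) = real n * sqrt (real m)"
  \<comment> \<open>Rewriting the entries to \<open>to_sign\<close> first would hide the pattern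
    that \<open>variance_sign_matrix\<close> matches.\<close>
  unfolding T1_def by (simp add: variance_sign_matrix del: index_sign_matrix)

lemma T2_sign_matrix: "T2 (sign_space m n) m n (sign_matrix m n) = real m * sqrt (real n)"
  unfolding T2_def by (simp add: variance_sign_matrix del: index_sign_matrix)

lemma inf_to_one_norm_sign_column:
  "inf_to_one_norm (0\<^sub>m m 1 - sign_matrix m 1 \<omega>) = real m"
  using inf_to_one_norm_rank_one_signs[of "0\<^sub>m m 1 - sign_matrix m 1 \<omega>" m 1
      "\<lambda>j. - to_sign (\<omega> (j, 0))" "\<lambda>_. 1"] by (simp add: minus_carrier_mat)

text \<open>With no columns the supremum would range over the empty set; hence the row case is
  stated for positive n only.\<close>

lemma inf_to_one_norm_sign_row:
  assumes "0 < n"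
  shows "inf_to_one_norm (0\<^sub>m 1 n - sign_matrix 1 n \<omega>) = real n"
  using inf_to_one_norm_rank_one_signs[of "0\<^sub>m 1 n - sign_matrix 1 n \<omega>" 1 n
      "\<lambda>_. 1" "\<lambda>k. - to_sign (\<omega> (0, k))"] assms by (simp add: minus_carrier_mat)

theorem mainTheorem9:
  shows
    "(\<exists>(m :: nat \<Rightarrow> nat) (n :: nat \<Rightarrow> nat) (A :: nat \<Rightarrow> real mat)
        (M :: nat \<Rightarrow> (nat \<times> nat \<Rightarrow> real) measure)
        (X :: nat \<Rightarrow> (nat \<times> nat \<Rightarrow> real) \<Rightarrow> real mat) (c :: real) (C :: real).
        0 < c \<and> c \<le> C \<and>
        (\<forall>N\<ge>1.
           A N \<in> carrier_mat (m N) (n N) \<and>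
           indep_random_matrix (M N) (m N) (n N) (X N) \<and>
           expectation_mat (M N) (m N) (n N) (X N) = A N \<and>
           c * T2 (M N) (m N) (n N) (X N)
             \<le> prob_space.expectation (M N) (\<lambda>\<omega>. inf_to_one_norm (A N - X N \<omega>)) \<and>
           prob_space.expectation (M N) (\<lambda>\<omega>. inf_to_one_norm (A N - X N \<omega>))
             \<le> C * T2 (M N) (m N) (n N) (X N)) \<and>
        filterlim
          (\<lambda>N. prob_space.expectation (M N) (\<lambda>\<omega>. inf_to_one_norm (A N - X N \<omega>))
                 / T1 (M N) (m N) (n N) (X N))
          at_top sequentially)
   \<and> (\<exists>(m :: nat \<Rightarrow> nat) (n :: nat \<Rightarrow> nat) (A :: nat \<Rightarrow> real mat)
        (M :: nat \<Rightarrow> (nat \<times> nat \<Rightarrow> real) measure)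
        (X :: nat \<Rightarrow> (nat \<times> nat \<Rightarrow> real) \<Rightarrow> real mat) (c :: real) (C :: real).
        0 < c \<and> c \<le> C \<and>
        (\<forall>N\<ge>1.
           A N \<in> carrier_mat (m N) (n N) \<and>
           indep_random_matrix (M N) (m N) (n N) (X N) \<and>
           expectation_mat (M N) (m N) (n N) (X N) = A N \<and>
           c * T1 (M N) (m N) (n N) (X N)
             \<le> prob_space.expectation (M N) (\<lambda>\<omega>. inf_to_one_norm (A N - X N \<omega>)) \<and>
           prob_space.expectation (M N) (\<lambda>\<omega>. inf_to_one_norm (A N - X N \<omega>))
             \<le> C * T1 (M N) (m N) (n N) (X N)) \<and>
        filterlim
          (\<lambda>N. prob_space.expectation (M N) (\<lambda>\<omega>. inf_to_one_norm (A N - X N \<omega>))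
                 / T2 (M N) (m N) (n N) (X N))
          at_top sequentially)" (is "?column \<and> ?row")
proof (rule conjI)
  let ?E = "\<lambda>m n. prob_space.expectation (sign_space m n)
      (\<lambda>\<omega>. inf_to_one_norm (0\<^sub>m m n - sign_matrix m n \<omega>))"
  note sign_facts = indep_random_matrix_sign_matrix expectation_sign_matrix
    T1_sign_matrix T2_sign_matrix
  \<comment> \<open>The norm is the same for every outcome, so its expectation under a probability
    measure is that constant.\<close>
  have column: "?E N 1 = real N" for N
    using prob_space.prob_space[OF prob_space_sign_space]
    by (simp only: inf_to_one_norm_sign_column) simp
  have row: "?E 1 N = real N" if "N \<ge> 1" for N
    using that prob_space.prob_space[OF prob_space_sign_space]
    by (subst inf_to_one_norm_sign_row) auto
  \<comment> \<open>Stated for any f that agrees with N from 1 on, so that it serves both families: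
    \<open>row\<close> says nothing about N = 0, and the limit ignores that value.\<close>
  have lim: "filterlim (\<lambda>N. f N / sqrt (real N)) at_top sequentially"
    if "\<And>N. N \<ge> 1 \<Longrightarrow> f N = real N" for f :: "nat \<Rightarrow> real"
  proof -
    have "filterlim (\<lambda>N. sqrt (real N)) at_top sequentially"
      by (rule filterlim_compose[OF sqrt_at_top filterlim_real_sequentially])
    moreover have "eventually (\<lambda>N. sqrt (real N) = f N / sqrt (real N)) sequentially"
      using eventually_ge_at_top[of 1] by eventually_elim (simp add: that real_div_sqrt)
    ultimately show ?thesis
      by (simp add: filterlim_cong[OF refl refl])
  qed
  show ?column
    \<comment> \<open>Both constants are 1, since the two-sided bound holds with equality. Removing
      \<open>One_nat_def\<close> keeps the dimension 1 in the form in which \<open>column\<close> is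
      stated.\<close>
    by (intro exI[of _ "\<lambda>N. N"] exI[of _ "\<lambda>_. 1"] exI[of _ "\<lambda>N. 0\<^sub>m N 1"]
        exI[of _ "\<lambda>N. sign_space N 1"] exI[of _ "\<lambda>N. sign_matrix N 1"] exI[of _ 1])
      (auto simp: sign_facts column simp del: One_nat_def intro!: lim)
  show ?row
    by (intro exI[of _ "\<lambda>_. 1"] exI[of _ "\<lambda>N. N"] exI[of _ "\<lambda>N. 0\<^sub>m 1 N"]
        exI[of _ "\<lambda>N. sign_space 1 N"] exI[of _ "\<lambda>N. sign_matrix 1 N"] exI[of _ 1])
      (auto simp: sign_facts row simp del: One_nat_def intro!: lim)
qed

end
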